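(* Let $M$ be $\mathbb{Z}\setminus\{0\}$ or $\mathbb{Z}_{>0}$, let $p,q\in M$, and let $c,d\in M$. If $c$ and $d$ lie in different elements of $H_{p,q}$ (that is, in different cosets of $\mathrm{Ker}\,\phi_{p,q}$ in $F$), then $c\nsim d$, where $\sim$ is the equivalence relation of $\mathcal{C}_{p,q}^{M}$. Consequently, the number of different equivalence classes of $\sim$ on $M$ is at least the order of $H_{p,q}$.
   Context: Let $M$ be either $\mathbb{Z}\setminus\{0\}$ or $\mathbb{Z}_{>0}$. For $p,q\in M$, the division sequence is the mapping $\mathcal{C}_{p,q}^{M}:M\to M$ given by $\mathcal{C}_{p,q}^{M}(c)=c/q$ if $q$ divides $c$, and $\mathcal{C}_{p,q}^{M}(c)=pc+1$ if $q$ does not divide $c$. All parameters $p,q$ are assumed to be such that this formula takes values in $M$. The relation $\sim$ (depending on $p,q,M$) is the smallest equivalence relation on $M$ such that $c\sim \mathcal{C}_{p,q}^{M}(c)$ for all $c\in M$. Let $F=K(M)$ be the Grothendieck group of the multiplicative monoid $M$: $F=\mathbb{Q}\setminus\{0\}$ if $M=\mathbb{Z}\setminus\{0\}$ and $F=\mathbb{Q}_{>0}$ if $M=\mathbb{Z}_{>0}$, under multiplication. The (abelian) group $H_{p,q}$ is the quotient of $F$ by the relations $q=1$ and $P=Q$ for all $P,Q\in M$ with $P\sim Q$; that is, the quotient of $F$ by the subgroup generated by $q$ and all $PQ^{-1}$ with $P,Q\in M$, $P\sim Q$. The map $\phi_{p,q}:F\to H_{p,q}$ is the quotient homomorphism.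 *)

theory Defs
  imports "HOL-Algebra.Algebra" "HOL-Library.Equipollence"
begin

definition division_seq :: "int \<Rightarrow> int \<Rightarrow> int \<Rightarrow> int" where
  "division_seq p q c = (if q dvd c then c div q else p * c + 1)"

text \<open>The smallest equivalence relation on \<open>M\<close> relating each element of \<open>M\<close> to its image. If the
  division sequence does not map \<open>M\<close> into itself, the intersection is over the empty family.\<close>

definition division_equiv :: "int set \<Rightarrow> int \<Rightarrow> int \<Rightarrow> (int \<times> int) set" where
  "division_equiv M p q = \<Inter> {r. equiv M r \<and> (\<forall>c\<in>M. (c, division_seq p q c) \<in> r)}"

lemma equiv_division_equiv:
  assumes "division_seq p q \<in> M \<rightarrow> M"
  shows "equiv M (division_equiv M p q)"
proof -
  have "equiv M (M \<times> M)"
    by (auto simp: equiv_def refl_on_def sym_def trans_def)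
  moreover have "\<forall>c\<in>M. (c, division_seq p q c) \<in> M \<times> M"
    using assms by auto
  ultimately have sub: "division_equiv M p q \<subseteq> M \<times> M"
    unfolding division_equiv_def by blast
  moreover have "refl_on M (division_equiv M p q)"
    by (auto simp: division_equiv_def equiv_def intro!: refl_onI dest: refl_onD)
  moreover have "sym (division_equiv M p q)"
    by (auto simp: division_equiv_def equiv_def intro!: symI dest: symD)
  moreover have "trans (division_equiv M p q)"
    unfolding division_equiv_def equiv_def by (intro trans_INTER[of _ id, simplified] ballI) auto
  ultimately show ?thesis
    by (simp add: equiv_def)
qed

text \<open>The Grothendieck group of a multiplicative monoid \<open>M\<close> of nonzero integers, realised as the
  group of fractions inside the rationals.\<close>

definition frac_group :: "int set \<Rightarrow> rat monoid" where
  "frac_group M =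
     \<lparr>carrier = {of_int a / of_int b | a b. a \<in> M \<and> b \<in> M}, monoid.mult = (*), one = 1\<rparr>"

lemma carrier_frac_group_nonzero: "carrier (frac_group {c. c \<noteq> 0}) = {x. x \<noteq> 0}"
proof -
  have "\<exists>a b. x = of_int a / of_int b \<and> a \<noteq> 0 \<and> b \<noteq> 0" if "x \<noteq> 0" for x :: rat
  proof (cases x)
    case (Fract a b)
    then have "x = of_int a / of_int b \<and> a \<noteq> 0 \<and> b \<noteq> 0"
      using that by (auto simp: Fract_of_int_quotient)
    then show ?thesis
      by blast
  qed
  then show ?thesis
    by (auto simp: frac_group_def)
qed

lemma carrier_frac_group_pos: "carrier (frac_group {c. c > 0}) = {x. x > 0}"
proof -
  have "\<exists>a b. x = of_int a / of_int b \<and> a > 0 \<and> b > 0" if "x > 0" for x :: rat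
  proof (cases x)
    case (Fract a b)
    then have "x = of_int a / of_int b \<and> a > 0 \<and> b > 0"
      using that by (auto simp: Fract_of_int_quotient zero_less_divide_iff)
    then show ?thesis
      by blast
  qed
  then show ?thesis
    by (auto simp: frac_group_def)
qed

lemma comm_group_frac_group:
  assumes "M = {c. c \<noteq> 0} \<or> M = {c. c > 0}"
  shows "comm_group (frac_group M)"
proof -
  have car: "carrier (frac_group M) = {x. x \<noteq> 0} \<or> carrier (frac_group M) = {x. x > 0}"
    using assms carrier_frac_group_nonzero carrier_frac_group_pos by metis
  have ops: "x \<otimes>\<^bsub>frac_group M\<^esub> y = x * y" "\<one>\<^bsub>frac_group M\<^esub> = 1" for x y
    by (simp_all add: frac_group_def)
  have one: "1 \<in> carrier (frac_group M)"
    using car by (elim disjE) simp_all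
  have mult: "x * y \<in> carrier (frac_group M)"
    if "x \<in> carrier (frac_group M)" "y \<in> carrier (frac_group M)" for x y
    using car that by (elim disjE) simp_all
  have inv: "inverse x \<in> carrier (frac_group M) \<and> inverse x * x = 1"
    if "x \<in> carrier (frac_group M)" for x
    using car that by (elim disjE) simp_all
  show ?thesis
    by (rule comm_groupI) (use one mult inv in \<open>auto simp: ops mult.assoc mult.commute\<close>)
qed

definition relation_subgroup :: "int set \<Rightarrow> int \<Rightarrow> int \<Rightarrow> rat set" where
  "relation_subgroup M p q =
     generate (frac_group M)
       (insert (of_int q) {of_int P / of_int Q | P Q. (P, Q) \<in> division_equiv M p q})"

definition H_group :: "int set \<Rightarrow> int \<Rightarrow> int \<Rightarrow> rat set monoid" where
  "H_group M p q = frac_group M Mod relation_subgroup M p q"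

definition H_proj :: "int set \<Rightarrow> int \<Rightarrow> int \<Rightarrow> rat \<Rightarrow> rat set" where
  "H_proj M p q x = relation_subgroup M p q #>\<^bsub>frac_group M\<^esub> x"

lemma
  assumes M: "M = {c. c \<noteq> 0} \<or> M = {c. c > 0}"
    and q: "q \<in> M" and closed: "division_seq p q \<in> M \<rightarrow> M"
  shows relation_subgroup_normal: "relation_subgroup M p q \<lhd> frac_group M"
    and H_proj_hom: "H_proj M p q \<in> hom (frac_group M) (H_group M p q)"
    and kernel_H_proj:
      "kernel (frac_group M) (H_group M p q) (H_proj M p q) = relation_subgroup M p q"
    and carrier_H_group:
      "carrier (H_group M p q) =
         rcosets\<^bsub>frac_group M\<^esub> (kernel (frac_group M) (H_group M p q) (H_proj M p q))"
proof -
  interpret F: comm_group "frac_group M"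
    using M by (rule comm_group_frac_group)
  have "division_equiv M p q \<subseteq> M \<times> M"
    using equiv_division_equiv[OF closed] by (simp add: equiv_def)
  moreover have "of_int q \<in> carrier (frac_group M)"
  proof -
    have "(of_int q :: rat) = of_int q / of_int 1" "1 \<in> M"
      using M by auto
    then show ?thesis
      using q unfolding frac_group_def partial_object.simps by blast
  qed
  ultimately have "insert (of_int q) {of_int P / of_int Q | P Q. (P, Q) \<in> division_equiv M p q}
      \<subseteq> carrier (frac_group M)"
    by (auto simp: frac_group_def)
  then have "subgroup (relation_subgroup M p q) (frac_group M)"
    unfolding relation_subgroup_def by (rule F.generate_is_subgroup)
  then show normal: "relation_subgroup M p q \<lhd> frac_group M"
    by (rule F.subgroup_imp_normal)
  show "H_proj M p q \<in> hom (frac_group M) (H_group M p q)"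
    using normal.r_coset_hom_Mod[OF normal] by (simp add: H_proj_def[abs_def] H_group_def)
  show ker: "kernel (frac_group M) (H_group M p q) (H_proj M p q) = relation_subgroup M p q"
  proof -
    let ?N = "relation_subgroup M p q"
    have N: "subgroup ?N (frac_group M)"
      using normal by (rule normal_imp_subgroup)
    have "?N #>\<^bsub>frac_group M\<^esub> x = ?N \<longleftrightarrow> x \<in> ?N" if "x \<in> carrier (frac_group M)" for x
      using F.coset_join1[OF _ that N] F.coset_join2[OF that N] by blast
    moreover have "?N \<subseteq> carrier (frac_group M)"
      using N by (rule subgroup.subset)
    ultimately show ?thesis
      unfolding kernel_def H_group_def H_proj_def FactGroup_def by auto
  qed
  show "carrier (H_group M p q) =
      rcosets\<^bsub>frac_group M\<^esub> (kernel (frac_group M) (H_group M p q) (H_proj M p q))"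
    unfolding ker by (simp add: H_group_def FactGroup_def)
qed

end

theory Submission
  imports Defs
begin

text \<open>
  Let \<open>N\<close> be the relation subgroup, which is the kernel of the projection onto \<open>H\<close>. It contains
  every quotient \<open>P / Q\<close> of equivalent \<open>P\<close> and \<open>Q\<close>, so equivalent elements lie in the same coset of
  \<open>N\<close>; this is the first claim. It also shows that \<open>c \<mapsto> N c\<close> induces a map from the equivalence
  classes to \<open>H\<close>.

  This map need not be surjective, because the cosets of elements of \<open>M\<close> only form a submonoid that
  generates \<open>H\<close>: for \<open>q = 1\<close> and \<open>M\<close> the positive integers, \<open>N\<close> is trivial and \<open>H\<close> is the group of
  positive rationals. The second claim therefore distinguishes two cases. If there are infinitely
  many classes, they are at least as many as the elements of \<open>H\<close>, since \<open>H\<close> is a quotient of a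
  countable group. If there are finitely many classes, the submonoid is finite, and a finite
  submonoid of a group is a subgroup: two powers of \<open>b \<in> M\<close> lie in the same coset, so \<open>1 / b\<close> lies in
  the coset of a power of \<open>b\<close> (lemma \<open>fraction_coset_represented\<close>). Hence the induced map is
  surjective in this case.
\<close>

lemma congruent_image_lepoll_quotient:
  assumes r: "equiv A r" and f: "f respects r"
  shows "f ` A \<lesssim> A // r"
proof -
  let ?g = "\<lambda>K. f (SOME x. x \<in> K)"
  have "f a \<in> ?g ` (A // r)" if a: "a \<in> A" for a
  proof -
    have "a \<in> r `` {a}"
      using equiv_class_self[OF r a] .
    then have "(SOME x. x \<in> r `` {a}) \<in> r `` {a}"
      by (rule someI)
    then have "f a = ?g (r `` {a})"
      by (intro congruentD[OF f]) simp
    then show ?thesis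
      using quotientI[OF a] by (rule image_eqI)
  qed
  then have "f ` A \<subseteq> ?g ` (A // r)"
    by blast
  then show ?thesis
    unfolding lepoll_iff by (rule exI[of _ ?g])
qed

lemma countable_lepoll_infinite:
  assumes "countable A" and "infinite B"
  shows "lepoll A B"
proof -
  have "lepoll A (UNIV :: nat set)"
    using assms(1) by (auto simp: countable_def lepoll_def)
  moreover have "lepoll (UNIV :: nat set) B"
    using assms(2) by (simp add: infinite_le_lepoll)
  ultimately show ?thesis
    by (rule lepoll_trans)
qed

lemma of_int_in_frac_group:
  assumes "M = {c. c \<noteq> 0} \<or> M = {c. c > 0}" and "c \<in> M"
  shows "of_int c \<in> carrier (frac_group M)"
  using assms carrier_frac_group_nonzero carrier_frac_group_pos by auto

lemma frac_group_coset_eq_iff: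
  assumes M: "M = {c. c \<noteq> 0} \<or> M = {c. c > 0}"
    and N: "subgroup N (frac_group M)"
    and x: "x \<in> carrier (frac_group M)" and y: "y \<in> carrier (frac_group M)"
  shows "N #>\<^bsub>frac_group M\<^esub> x = N #>\<^bsub>frac_group M\<^esub> y \<longleftrightarrow> x / y \<in> N"
proof -
  interpret F: comm_group "frac_group M"
    using M by (rule comm_group_frac_group)
  have ops: "u \<otimes>\<^bsub>frac_group M\<^esub> v = u * v" for u v
    by (simp add: frac_group_def)
  have y0: "y \<noteq> 0"
    using M y carrier_frac_group_nonzero carrier_frac_group_pos by auto
  show ?thesis
  proof
    assume "N #>\<^bsub>frac_group M\<^esub> x = N #>\<^bsub>frac_group M\<^esub> y"
    then have "x \<in> N #>\<^bsub>frac_group M\<^esub> y"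
      using F.rcos_self[OF x N] by simp
    then show "x / y \<in> N"
      using y0 by (auto simp: r_coset_def ops)
  next
    assume "x / y \<in> N"
    then have "x \<in> N #>\<^bsub>frac_group M\<^esub> y"
      using y0 by (auto simp: r_coset_def ops intro!: bexI[of _ "x / y"])
    then show "N #>\<^bsub>frac_group M\<^esub> x = N #>\<^bsub>frac_group M\<^esub> y"
      using F.repr_independence[OF _ y N] by simp
  qed
qed

text \<open>
  By the pigeonhole principle \<open>b ^ i\<close> and \<open>b ^ j\<close> lie in the same coset for some \<open>i < j\<close>. Then
  \<open>b ^ (j - i)\<close> lies in \<open>N\<close>, so \<open>b ^ (j - i - 1)\<close> represents the inverse of \<open>b\<close> modulo \<open>N\<close>.
\<close>

lemma fraction_coset_represented:
  assumes M: "M = {c. c \<noteq> 0} \<or> M = {c. c > 0}"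
    and N: "subgroup N (frac_group M)"
    and fin: "finite ((\<lambda>c. N #>\<^bsub>frac_group M\<^esub> of_int c) ` M)"
    and a: "a \<in> M" and b: "b \<in> M"
  shows "N #>\<^bsub>frac_group M\<^esub> (of_int a / of_int b) \<in> (\<lambda>c. N #>\<^bsub>frac_group M\<^esub> of_int c) ` M"
proof -
  let ?f = "\<lambda>c. N #>\<^bsub>frac_group M\<^esub> of_int c"
  have b0: "b \<noteq> 0" and a0: "a \<noteq> 0"
    using M a b by auto
  have pow: "b ^ n \<in> M" for n
    using M b by auto
  have "range (\<lambda>n. ?f (b ^ n)) \<subseteq> ?f ` M"
    using pow by blast
  then have "finite (range (\<lambda>n. ?f (b ^ n)))"
    using fin by (rule finite_subset)
  then have "\<not> inj (\<lambda>n. ?f (b ^ n))"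
    using finite_imageD infinite_UNIV_nat by blast
  then obtain i j where "i < j" and "?f (b ^ j) = ?f (b ^ i)"
    by (metis (lifting) injI linorder_neqE_nat)
  then have "(of_int (b ^ j) :: rat) / of_int (b ^ i) \<in> N"
    using frac_group_coset_eq_iff[OF M N] of_int_in_frac_group[OF M pow] by simp
  then have "(of_int b :: rat) ^ (j - i) \<in> N"
    using \<open>i < j\<close> b0 by (simp add: power_diff)
  moreover obtain k where "j - i = Suc k"
    using \<open>i < j\<close> by (metis Suc_diff_Suc)
  ultimately have k: "(of_int b :: rat) ^ Suc k \<in> N"
    by simp
  have ab: "a * b ^ k \<in> M"
    using M a b by auto
  have "(of_int (a * b ^ k) :: rat) / (of_int a / of_int b) = of_int b ^ Suc k"
    using a0 b0 by (simp add: field_simps)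
  moreover have "(of_int a / of_int b :: rat) \<in> carrier (frac_group M)"
    using a b by (auto simp: frac_group_def)
  ultimately have "?f (a * b ^ k) = N #>\<^bsub>frac_group M\<^esub> (of_int a / of_int b)"
    using frac_group_coset_eq_iff[OF M N of_int_in_frac_group[OF M ab]] k by simp
  then show ?thesis
    using ab by (metis (lifting) image_eqI)
qed

theorem corollary4:
  fixes M :: "int set" and p q :: int
  assumes "M = {c. c \<noteq> 0} \<or> M = {c. c > 0}"
    and "p \<in> M" and "q \<in> M"
    and "division_seq p q \<in> M \<rightarrow> M"
  shows "(\<forall>c\<in>M. \<forall>d\<in>M.
            kernel (frac_group M) (H_group M p q) (H_proj M p q) #>\<^bsub>frac_group M\<^esub> of_int c \<noteq>
            kernel (frac_group M) (H_group M p q) (H_proj M p q) #>\<^bsub>frac_group M\<^esub> of_int d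
            \<longrightarrow> (c, d) \<notin> division_equiv M p q)
       \<and> carrier (H_group M p q) \<lesssim> M // division_equiv M p q"
proof -
  let ?F = "frac_group M"
  let ?r = "division_equiv M p q"
  define N where "N = relation_subgroup M p q"
  let ?f = "\<lambda>c. N #>\<^bsub>?F\<^esub> of_int c"
  have ker: "kernel ?F (H_group M p q) (H_proj M p q) = N"
    unfolding N_def using assms(1,3,4) by (rule kernel_H_proj)
  have N: "subgroup N ?F"
    unfolding N_def using relation_subgroup_normal[OF assms(1,3,4)] by (rule normal_imp_subgroup)
  have H: "carrier (H_group M p q) = (\<lambda>x. N #>\<^bsub>?F\<^esub> x) ` carrier ?F"
    using carrier_H_group[OF assms(1,3,4)] unfolding ker by (auto simp: RCOSETS_def)
  have r: "equiv M ?r"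
    using assms(4) by (rule equiv_division_equiv)
  have resp: "?f c = ?f d" if cd: "(c, d) \<in> ?r" for c d
  proof -
    have "c \<in> M" "d \<in> M"
      using r cd by (auto simp: equiv_def)
    moreover have "(of_int c :: rat) / of_int d \<in> N"
      unfolding N_def relation_subgroup_def using cd by (intro generate.incl) blast
    ultimately show ?thesis
      using frac_group_coset_eq_iff[OF assms(1) N] of_int_in_frac_group[OF assms(1)] by simp
  qed
  then have "?f respects ?r"
    by (rule congruentI)
  with r have le: "?f ` M \<lesssim> M // ?r"
    by (rule congruent_image_lepoll_quotient)
  have "carrier (H_group M p q) \<lesssim> M // ?r"
  proof (cases "finite (M // ?r)")
    case True
    moreover obtain g where "?f ` M \<subseteq> g ` (M // ?r)"
      using le unfolding lepoll_iff by (rule exE)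
    ultimately have fin: "finite (?f ` M)"
      by (rule finite_surj)
    have "carrier (H_group M p q) \<subseteq> ?f ` M"
    proof
      fix K assume "K \<in> carrier (H_group M p q)"
      then obtain a b where "a \<in> M" "b \<in> M" "K = N #>\<^bsub>?F\<^esub> (of_int a / of_int b)"
        unfolding H by (auto simp: frac_group_def)
      then show "K \<in> ?f ` M"
        using fraction_coset_represented[OF assms(1) N fin] by simp
    qed
    then show ?thesis
      by (rule lepoll_trans[OF subset_imp_lepoll le])
  next
    case False
    have "countable (carrier (H_group M p q))"
      unfolding H by (intro countable_image countableI_type)
    then show ?thesis
      using False by (rule countable_lepoll_infinite)
  qed
  moreover have "\<forall>c\<in>M. \<forall>d\<in>M. ?f c \<noteq> ?f d \<longrightarrow> (c, d) \<notin> ?r"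
    by (intro ballI impI notI) (erule notE, rule resp)
  ultimately show ?thesis
    unfolding ker by (intro conjI)
qed

end
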